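(* There exist strings of length $n$ for which Algorithm III uses only $O(n)$ space, while Algorithm II needs $\Theta(n^2)$ space.
   Context: **Problem.** Strings are over an alphabet $\Sigma$. A subsequence of a string is obtained by deleting zero or more characters; a substring is a contiguous block. $\mathrm{lcs}(X,Y)$ is the length of a longest common subsequence of $X$ and $Y$, and $X^R$ is the reversal of $X$. The input consists of two target strings $A,B$ of length $n$ (the "strings of length $n$" of the claim) and a pattern $P$ of length $r\le n$. A string $Z$ is an STR-IC-LCS of $A,B,P$ if it is a longest string such that $P$ is a substring of $Z$ and $Z$ is a common subsequence of $A$ and $B$; if there is none, its length is taken to be $-1$ by convention. The STR-IC-LCS problem is to compute such a $Z$. Write $\ell=\mathrm{lcs}(A,B)$ and let $\ell'$ be the length of an STR-IC-LCS of $A,B,P$. A minimal interval of $A$ is an interval $[i..j]$ such that $P$ is a subsequence of $A[i..j]$ but of neither $A[i+1..j]$ nor $A[i..j-1]$; similarly for $B$. The STR-IC-LCS length is the maximum, over pairs of minimal intervals $[b_A..e_A]$ of $A$ and $[b_B..e_B]$ of $B$, of $\mathrm{lcs}(A[1..b_A-1],B[1..b_B-1])+r+\mathrm{lcs}(A[e_A+1..n],B[e_B+1..n])$; the first and last terms are called prefix-LCS and suffix-LCS values. **Sparse tables.** For $s,i\in[1..n]$ let $f_A(s,i)$ be the length of the shortest prefix of $B$ whose longest common subsequence with $A[1..i]$ has length $s$ ($\infty$ if there is none). The sparse table $F_A$ stores $f_A(s,i)$, except that $F_A(s,i)$ is undefined if $s>i$, or $(s,i)$ lies on a diagonal $i-s+1>n-\ell+1$,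 or $F_A(s-1,i-1)$ is $\infty$ or undefined. $F_B$ is defined with the roles of $A$ and $B$ exchanged, and $F_{A^R},F_{B^R}$ are the analogous tables for $A^R,B^R$. **Algorithm II.** It computes all minimal intervals of $A$ and $B$ in $O(nr/\log r)$ time and $O(n)$ space; stores them in two arrays of size $n$ indexed by beginning position (positions where no interval begins point to the next position where one does); builds $F_A,F_B,F_{A^R},F_{B^R}$; and obtains the prefix-LCS values from $F_A,F_B$ and the suffix-LCS values from $F_{A^R},F_{B^R}$, skipping pairs of intervals that would only rescan the same table cell, with two further arrays of size $n$ recording where to restart scanning in the columns of $F_{A^R}$ and $F_{B^R}$. It runs in $O(nr/\log r+n(n-\ell+1))$ time and $O((\ell+1)(n-\ell+1))$ space. **Algorithm III.** It first computes the minimal intervals as in Algorithm II. Let $\max b_A$ and $\max b_B$ be the beginning positions of the rightmost minimal intervals in $A$ and $B$. For the prefix-LCS queries it applies the method of Algorithm II with the sparse tables and other auxiliary tables built only for $\hat A=A[1..\max b_A-1]$ and $\hat B=B[1..\max b_B-1]$; the same techniques are used for the suffix-LCS queries. It runs in $O(nr/\log r+n(n-\ell'+1))$ time and $O((\ell'+1)(n-\ell'+1))$ space. *)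

theory Defs
  imports Complex_Main
    "HOL-Library.Sublist"
    "HOL-Library.Extended_Nat"
    "HOL-Library.Landau_Symbols"
begin

section \<open>Strings\<close>

text \<open>Strings are lists over the alphabet \<open>'a\<close>; positions are 1-based, as usual for strings.\<close>

definition substr :: "'a list \<Rightarrow> nat \<Rightarrow> nat \<Rightarrow> 'a list" where
  "substr X i j = drop (i - 1) (take j X)"

definition lcs :: "'a list \<Rightarrow> 'a list \<Rightarrow> nat" where
  "lcs X Y = Max {length Z | Z. subseq Z X \<and> subseq Z Y}"

definition minimal_interval :: "'a list \<Rightarrow> 'a list \<Rightarrow> nat \<Rightarrow> nat \<Rightarrow> bool" where
  "minimal_interval P X b e \<longleftrightarrow>
     1 \<le> b \<and> b \<le> e \<and> e \<le> length X \<and> subseq P (substr X b e) \<and>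
     \<not> subseq P (substr X (b + 1) e) \<and> \<not> subseq P (substr X b (e - 1))"


section \<open>Sparse tables\<close>

text \<open>The infimum of the empty set is \<open>\<infinity>\<close> in \<^typ>\<open>enat\<close>.\<close>

definition shortest_prefix :: "'a list \<Rightarrow> 'a list \<Rightarrow> nat \<Rightarrow> nat \<Rightarrow> enat" where
  "shortest_prefix X Y s i = (INF j \<in> {j. j \<le> length Y \<and> lcs (take i X) (take j Y) = s}. enat j)"

text \<open>
  \<open>None\<close> is an undefined entry. Row 0 has the value 0 throughout; it only serves as the
  predecessor of row 1 and is not part of the table. The two strings may have different lengths:
  the diagonals of the table are cut off using the length of the string indexing its columns.
\<close>

fun table_entry :: "'a list \<Rightarrow> 'a list \<Rightarrow> nat \<Rightarrow> nat \<Rightarrow> enat option" where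
  "table_entry X Y 0 i = Some 0"
| "table_entry X Y (Suc s) 0 = None"
| "table_entry X Y (Suc s) (Suc i) =
     (if Suc s > Suc i \<or> Suc i - Suc s + 1 > length X - lcs X Y + 1 \<or>
         table_entry X Y s i = None \<or> table_entry X Y s i = Some \<infinity>
      then None else Some (shortest_prefix X Y (Suc s) (Suc i)))"

type_synonym table = "nat \<times> nat \<rightharpoonup> enat"

definition sparse_table :: "'a list \<Rightarrow> 'a list \<Rightarrow> table" where
  "sparse_table X Y = (\<lambda>(s, i).
     if s \<in> {1..length X} \<and> i \<in> {1..length X} then table_entry X Y s i else None)"


section \<open>Stored data and space\<close>

text \<open>
  An array of intervals has one slot per position \<open>b\<close>: the end of the interval beginning at \<open>b\<close>,
  or a pointer to the next position at which an interval begins, if there is one.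
\<close>

datatype slot = End nat | Next nat | Nil_slot

definition interval_array :: "'a list \<Rightarrow> 'a list \<Rightarrow> slot list" where
  "interval_array P X = map (\<lambda>b.
     if \<exists>e. minimal_interval P X b e then End (THE e. minimal_interval P X b e)
     else if \<exists>b'>b. \<exists>e. minimal_interval P X b' e
       then Next (LEAST b'. b < b' \<and> (\<exists>e. minimal_interval P X b' e))
     else Nil_slot) [1..<length X + 1]"

text \<open>
  The restart arrays record where to resume scanning the columns of the two suffix tables. They
  save time but do not influence the values found, so only their initial contents is modelled.
\<close>

record memory =
  intervals_A :: "slot list"
  intervals_B :: "slot list"
  prefix_A :: table
  prefix_B :: table
  suffix_A :: table
  suffix_B :: table
  restart_A :: "nat list"
  restart_B :: "nat list"

text \<open>One word per array slot and per defined table entry (an entry \<open>\<infinity>\<close> is defined).\<close>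

definition words :: "memory \<Rightarrow> nat" where
  "words m = length (intervals_A m) + length (intervals_B m)
     + card (dom (prefix_A m)) + card (dom (prefix_B m))
     + card (dom (suffix_A m)) + card (dom (suffix_B m))
     + length (restart_A m) + length (restart_B m)"


section \<open>Queries\<close>

text \<open>
  The length of a longest common subsequence of the prefixes of lengths \<open>i\<close> and \<open>j\<close>, read off
  column \<open>i\<close> of the table \<open>T\<close> of \<open>X\<close> against \<open>Y\<close> and column \<open>j\<close> of the table \<open>U\<close> of \<open>Y\<close> against
  \<open>X\<close>. Both are needed because either table alone lacks the diagonals that were cut off.
\<close>

definition table_lcs :: "table \<Rightarrow> table \<Rightarrow> nat \<Rightarrow> nat \<Rightarrow> nat" where
  "table_lcs T U i j = Max ({0} \<union> {s. \<exists>v. T (s, i) = Some v \<and> v \<le> enat j}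
                                \<union> {s. \<exists>v. U (s, j) = Some v \<and> v \<le> enat i})"

definition stored_intervals :: "slot list \<Rightarrow> (nat \<times> nat) set" where
  "stored_intervals xs = {(b, e). b \<in> {1..length xs} \<and> xs ! (b - 1) = End e}"

text \<open>
  The length found by a run for strings of length \<open>n\<close> and a pattern of length \<open>r\<close>; it depends on
  the strings only through the stored data. Suffixes are prefixes of the reversed strings.
\<close>

definition query :: "nat \<Rightarrow> nat \<Rightarrow> memory \<Rightarrow> int" where
  "query n r m =
     (let S = stored_intervals (intervals_A m) \<times> stored_intervals (intervals_B m) in
      if S = {} then -1
      else Max ((\<lambda>((bA, eA), (bB, eB)).
             int (table_lcs (prefix_A m) (prefix_B m) (bA - 1) (bB - 1) + r
                  + table_lcs (suffix_A m) (suffix_B m) (n - eA) (n - eB))) ` S))"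


section \<open>The algorithms\<close>

definition memory_II :: "'a list \<Rightarrow> 'a list \<Rightarrow> 'a list \<Rightarrow> memory" where
  "memory_II A B P = \<lparr>
     intervals_A = interval_array P A,
     intervals_B = interval_array P B,
     prefix_A = sparse_table A B,
     prefix_B = sparse_table B A,
     suffix_A = sparse_table (rev A) (rev B),
     suffix_B = sparse_table (rev B) (rev A),
     restart_A = replicate (length A) 0,
     restart_B = replicate (length B) 0\<rparr>"

text \<open>
  The longest prefix preceding, and the longest suffix following, a minimal interval: they are
  cut at the beginning of the rightmost and at the end of the leftmost minimal interval. They are
  empty if there is no minimal interval, since then no query is made.
\<close>

definition hat_prefix :: "'a list \<Rightarrow> 'a list \<Rightarrow> 'a list" where
  "hat_prefix P X = (if \<exists>b e. minimal_interval P X b e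
     then substr X 1 (Max {b. \<exists>e. minimal_interval P X b e} - 1) else [])"

definition hat_suffix :: "'a list \<Rightarrow> 'a list \<Rightarrow> 'a list" where
  "hat_suffix P X = (if \<exists>b e. minimal_interval P X b e
     then substr X (Min {e. \<exists>b. minimal_interval P X b e} + 1) (length X) else [])"

definition memory_III :: "'a list \<Rightarrow> 'a list \<Rightarrow> 'a list \<Rightarrow> memory" where
  "memory_III A B P =
     (let A\<^sub>p = hat_prefix P A; B\<^sub>p = hat_prefix P B;
          A\<^sub>s = hat_suffix P A; B\<^sub>s = hat_suffix P B
      in \<lparr>
     intervals_A = interval_array P A,
     intervals_B = interval_array P B,
     prefix_A = sparse_table A\<^sub>p B\<^sub>p,
     prefix_B = sparse_table B\<^sub>p A\<^sub>p,
     suffix_A = sparse_table (rev A\<^sub>s) (rev B\<^sub>s),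
     suffix_B = sparse_table (rev B\<^sub>s) (rev A\<^sub>s),
     restart_A = replicate (length A\<^sub>s) 0,
     restart_B = replicate (length B\<^sub>s) 0\<rparr>)"

text \<open>
  \<open>w A B P\<close> is the number of further words in use: the input, scalar variables, and the working
  space of the procedure computing the minimal intervals, which the algorithms use as a black box
  known to run in space linear in the length of the strings.
\<close>

type_synonym 'a workspace = "'a list \<Rightarrow> 'a list \<Rightarrow> 'a list \<Rightarrow> nat"

definition linear_workspace :: "'a workspace \<Rightarrow> bool" where
  "linear_workspace w \<longleftrightarrow> (\<exists>c. \<forall>A B P. length A = length B \<and> 1 \<le> length P \<and> length P \<le> length A
     \<longrightarrow> w A B P \<le> c * length A)"

text \<open>A run yields the computed length and the number of words used.\<close>

definition algorithm_II :: "'a workspace \<Rightarrow> 'a list \<Rightarrow> 'a list \<Rightarrow> 'a list \<Rightarrow> int \<times> nat" where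
  "algorithm_II w A B P =
     (let m = memory_II A B P in (query (length A) (length P) m, words m + w A B P))"

definition algorithm_III :: "'a workspace \<Rightarrow> 'a list \<Rightarrow> 'a list \<Rightarrow> 'a list \<Rightarrow> int \<times> nat" where
  "algorithm_III w A B P =
     (let m = memory_III A B P in (query (length A) (length P) m, words m + w A B P))"

definition space :: "int \<times> nat \<Rightarrow> nat" where
  "space run = snd run"

end

theory Submission
  imports Defs
begin

text \<open>
  Take \<open>A = y\<^sup>n\<close>, \<open>B = x\<^sup>m y\<^sup>k\<close> and \<open>P = y\<^sup>k\<close> with \<open>m = \<lfloor>n/2\<rfloor>\<close> and \<open>k = \<lceil>n/2\<rceil>\<close>. The only longest
  common subsequence of \<open>A\<close> and \<open>B\<close> is \<open>P\<close>, so \<open>F\<^sub>A\<close> has \<open>k\<close> finite entries on each of its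
  \<open>m + 1\<close> diagonals and Algorithm II stores at least \<open>n\<^sup>2/4\<close> words. Every minimal interval of \<open>B\<close>
  contains all of \<open>y\<^sup>k\<close>, so the parts of \<open>B\<close> outside of it contain no \<open>y\<close> and have no character
  in common with \<open>A\<close>. All entries in the first row of each table of Algorithm III are
  therefore \<open>\<infinity>\<close>, and there is no second row.
\<close>

section \<open>Longest common subsequences\<close>

lemma finite_common_subseq_lengths: "finite {length Z | Z. subseq Z X \<and> subseq Z Y}"
  by (rule finite_subset[of _ "{..length X}"]) (auto dest: list_emb_length)

lemma length_le_lcs: "subseq Z X \<Longrightarrow> subseq Z Y \<Longrightarrow> length Z \<le> lcs X Y"
  unfolding lcs_def by (rule Max_ge[OF finite_common_subseq_lengths]) blast

lemma lcs_obtains: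
  obtains Z where "subseq Z X" "subseq Z Y" "length Z = lcs X Y"
proof -
  have "lcs X Y \<in> {length Z | Z. subseq Z X \<and> subseq Z Y}"
    unfolding lcs_def
    by (rule Max_in[OF finite_common_subseq_lengths]) (use list_emb_Nil in blast)
  with that show thesis by auto
qed

lemma lcs_mono:
  assumes "subseq X X'" "subseq Y Y'"
  shows "lcs X Y \<le> lcs X' Y'"
proof -
  obtain Z where Z: "subseq Z X" "subseq Z Y" "length Z = lcs X Y"
    by (rule lcs_obtains)
  with assms show ?thesis
    using length_le_lcs[of Z X' Y'] subseq_order.order_trans by metis
qed

lemma subseq_imp_set_subset: "subseq X Y \<Longrightarrow> set X \<subseteq> set Y"
  by (induction rule: list_emb.induct) auto

lemma subseq_imp_count_list_le: "subseq X Y \<Longrightarrow> count_list X a \<le> count_list Y a"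
  by (induction rule: list_emb.induct) auto

lemma lcs_disjoint:
  assumes "set X \<inter> set Y = {}"
  shows "lcs X Y = 0"
proof -
  obtain Z where "subseq Z X" "subseq Z Y" "length Z = lcs X Y"
    by (rule lcs_obtains)
  then have "set Z \<subseteq> set X \<inter> set Y"
    by (simp add: subseq_imp_set_subset)
  with assms \<open>length Z = lcs X Y\<close> show ?thesis by simp
qed

lemma subseq_replicate_count_list: "subseq (replicate (count_list Y y) y) Y"
  by (induction Y) auto

lemma subseq_replicate_mono: "i \<le> j \<Longrightarrow> subseq (replicate i y) (replicate j y)"
  by (metis le_add_diff_inverse replicate_add list_emb_prefix subseq_order.order_refl)

lemma count_list_replicate: "count_list (replicate n x) y = (if x = y then n else 0)"
  by (induction n) auto

text \<open>A subsequence of a power of \<open>y\<close> is itself a power of \<open>y\<close>, so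
  only the number of occurrences of \<open>y\<close> matters.\<close>

lemma lcs_replicate: "lcs (replicate i y) Y = min i (count_list Y y)"
proof (rule antisym)
  obtain Z where Z: "subseq Z (replicate i y)" "subseq Z Y" "length Z = lcs (replicate i y) Y"
    by (rule lcs_obtains)
  have "Z = replicate (length Z) y"
    using subseq_imp_set_subset[OF Z(1)] by (intro replicate_eqI) auto
  then have "count_list Z y = length Z"
    using count_list_replicate[of "length Z" y y] by simp
  then show "lcs (replicate i y) Y \<le> min i (count_list Y y)"
    using Z list_emb_length[OF Z(1)] subseq_imp_count_list_le[OF Z(2), of y] by simp
next
  have "subseq (replicate (min i (count_list Y y)) y) Y"
    by (meson min.cobounded2 subseq_replicate_mono subseq_replicate_count_list
        subseq_order.order_trans)
  then show "min i (count_list Y y) \<le> lcs (replicate i y) Y"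
    using length_le_lcs[OF subseq_replicate_mono] by (metis length_replicate min.cobounded1)
qed

lemma subseq_take: "subseq (take i X) X"
  by (simp add: prefix_imp_subseq take_is_prefix)


section \<open>The size of sparse tables\<close>

lemma dom_sparse_table_subset: "dom (sparse_table X Y) \<subseteq> {1..length X} \<times> {1..length X}"
  by (auto simp: sparse_table_def split: if_splits)

lemma finite_dom_sparse_table: "finite (dom (sparse_table X Y))"
  by (rule finite_subset[OF dom_sparse_table_subset]) simp

lemma card_dom_sparse_table_le: "card (dom (sparse_table X Y)) \<le> (length X)\<^sup>2"
  using card_mono[OF _ dom_sparse_table_subset[of X Y]]
  by (simp add: card_cartesian_product power2_eq_square)

text \<open>By monotonicity no pair of prefixes reaches \<open>s\<close>, so the infimum is over the
  empty set.\<close>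

lemma shortest_prefix_eq_infinity:
  assumes "lcs X Y < s"
  shows "shortest_prefix X Y s i = \<infinity>"
proof -
  have "lcs (take i X) (take j Y) < s" for j
    using lcs_mono[OF subseq_take subseq_take, of i X j Y] assms by linarith
  then have "{j. j \<le> length Y \<and> lcs (take i X) (take j Y) = s} = {}"
    by (metis (mono_tags, lifting) Collect_empty_eq less_irrefl)
  then show ?thesis
    unfolding shortest_prefix_def by (simp only: image_empty Inf_empty top_enat_def)
qed

lemma table_entry_eq_infinity:
  assumes "lcs X Y = 0"
  shows "table_entry X Y (Suc s) i \<in> {None, Some \<infinity>}"
  using assms by (cases i) (auto simp: shortest_prefix_eq_infinity)

text \<open>Row \<open>Suc s\<close> holds at most entries \<infinity>, and such a predecessor on
  the diagonal leaves the next entry undefined.\<close>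

lemma table_entry_eq_None:
  assumes "lcs X Y = 0"
  shows "table_entry X Y (Suc (Suc s)) i = None"
  using table_entry_eq_infinity[OF assms, of s] by (cases i) auto

text \<open>Only row 1 can have defined entries, which turns the quadratic bound into a linear
  one.\<close>

lemma card_dom_sparse_table_le_if_lcs_eq_0:
  assumes "lcs X Y = 0"
  shows "card (dom (sparse_table X Y)) \<le> length X"
proof -
  have "s = 1" if "sparse_table X Y (s, i) = Some v" for s i v
  proof (rule ccontr)
    assume "s \<noteq> 1"
    moreover have "s \<noteq> 0"
      using that by (auto simp: sparse_table_def split: if_splits)
    ultimately obtain t where "s = Suc (Suc t)"
      by (metis One_nat_def not0_implies_Suc)
    with that show False
      by (simp add: sparse_table_def table_entry_eq_None[OF assms] split: if_splits)
  qed
  then have "dom (sparse_table X Y) \<subseteq> {1} \<times> {1..length X}"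
    using dom_sparse_table_subset[of X Y] by fastforce
  from card_mono[OF _ this] show ?thesis
    by (simp add: card_cartesian_product)
qed

lemma shortest_prefix_finite:
  assumes "j \<le> length Y" "lcs (take i X) (take j Y) = s"
  shows "shortest_prefix X Y s i \<noteq> \<infinity>"
proof -
  have "shortest_prefix X Y s i \<le> enat j"
    unfolding shortest_prefix_def by (rule INF_lower) (use assms in simp)
  then show ?thesis by (metis enat.distinct(2) enat_ile)
qed

lemma shortest_prefix_replicate_finite:
  assumes "s \<le> i" "i \<le> n" "s \<le> k"
  shows "shortest_prefix (replicate n y) (replicate m x @ replicate k y) s i \<noteq> \<infinity>"
proof (cases "x = y")
  case True
  then show ?thesis
    using assms
    by (intro shortest_prefix_finite[where j = s])
      (auto simp: replicate_add[symmetric] lcs_replicate count_list_replicate)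
next
  case False
  then show ?thesis
    using assms
    \<comment> \<open>The block of \<open>x\<close> contributes nothing, so the prefix must reach
      \<open>s\<close> letters into the block of \<open>y\<close>.\<close>
    by (intro shortest_prefix_finite[where j = "m + s"])
      (auto simp: lcs_replicate count_list_replicate)
qed

text \<open>Induction along the diagonal with offset \<open>d\<close>, which lies within the cutoff
  because the LCS has length \<open>k\<close>. Finiteness belongs to the claim because an entry is
  defined only if its predecessor is finite.\<close>

lemma table_entry_replicate_finite:
  assumes "s \<le> k" "d + k \<le> n" "x \<noteq> y"
  shows "\<exists>v. table_entry (replicate n y) (replicate m x @ replicate k y) s (s + d) = Some v \<and> v \<noteq> \<infinity>"
  using assms(1)
proof (induction s)
  case (Suc s)
  have "lcs (replicate n y) (replicate m x @ replicate k y) = k"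
    using assms by (simp add: lcs_replicate count_list_replicate)
  then show ?case
    using Suc assms shortest_prefix_replicate_finite[of "Suc s" "Suc (s + d)" n k y m x] by auto
qed (simp add: zero_enat_def)

lemma card_dom_sparse_table_replicate_ge:
  assumes "k \<le> n" "x \<noteq> y"
  shows "k * (n - k + 1) \<le> card (dom (sparse_table (replicate n y) (replicate m x @ replicate k y)))"
    (is "_ \<le> card (dom ?T)")
proof -
  \<comment> \<open>Cells are addressed by row and diagonal offset: each of the
    \<open>n - k + 1\<close> diagonals supplies \<open>k\<close> cells.\<close>
  let ?f = "\<lambda>(s, d). (s, s + d)"
  let ?D = "{1..k} \<times> {0..n - k} :: (nat \<times> nat) set"
  have "?f ` ?D \<subseteq> dom ?T"
  proof safe
    fix s d :: nat
    assume sd: "s \<in> {1..k}" "d \<in> {0..n - k}"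
    then obtain v
      where "table_entry (replicate n y) (replicate m x @ replicate k y) s (s + d) = Some v"
      using table_entry_replicate_finite[of s k d n x y m] assms by fastforce
    with sd assms show "\<exists>v. ?T (s, s + d) = Some v"
      by (auto simp: sparse_table_def)
  qed
  then have "card (?f ` ?D) \<le> card (dom ?T)"
    by (rule card_mono[OF finite_dom_sparse_table])
  moreover have "inj_on ?f ?D"
    by (auto simp: inj_on_def)
  ultimately show ?thesis
    by (simp add: card_image card_cartesian_product)
qed


section \<open>The parts of a string outside its minimal intervals\<close>

lemma finite_minimal_interval_begins: "finite {b. \<exists>e. minimal_interval P X b e}"
  by (rule finite_subset[of _ "{..length X}"]) (auto simp: minimal_interval_def)

lemma finite_minimal_interval_ends: "finite {e. \<exists>b. minimal_interval P X b e}"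
  by (rule finite_subset[of _ "{..length X}"]) (auto simp: minimal_interval_def)

text \<open>What follows needs only that the cut is made at some minimal interval, not that this one
  is the rightmost.\<close>

lemma hat_prefix_cases:
  obtains "hat_prefix P X = []" | b e where "minimal_interval P X b e" "hat_prefix P X = take (b - 1) X"
proof (cases "\<exists>b e. minimal_interval P X b e")
  case True
  define b where "b = Max {b. \<exists>e. minimal_interval P X b e}"
  have "b \<in> {b. \<exists>e. minimal_interval P X b e}"
    unfolding b_def by (rule Max_in[OF finite_minimal_interval_begins]) (use True in blast)
  moreover have "hat_prefix P X = take (b - 1) X"
    using True by (simp add: hat_prefix_def b_def substr_def)
  ultimately show thesis using that by blast
qed (use that in \<open>simp add: hat_prefix_def\<close>)

lemma hat_suffix_cases:
  obtains "hat_suffix P X = []" | b e where "minimal_interval P X b e" "hat_suffix P X = drop e X"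
proof (cases "\<exists>b e. minimal_interval P X b e")
  case True
  define e where "e = Min {e. \<exists>b. minimal_interval P X b e}"
  have "e \<in> {e. \<exists>b. minimal_interval P X b e}"
    unfolding e_def by (rule Min_in[OF finite_minimal_interval_ends]) (use True in blast)
  moreover have "hat_suffix P X = drop e X"
    using True by (simp add: hat_suffix_def e_def substr_def)
  ultimately show thesis using that by blast
qed (use that in \<open>simp add: hat_suffix_def\<close>)

lemma length_hat_prefix_le: "length (hat_prefix P X) \<le> length X"
  by (rule hat_prefix_cases[of P X]) auto

lemma length_hat_suffix_le: "length (hat_suffix P X) \<le> length X"
  by (rule hat_suffix_cases[of P X]) auto

lemma set_hat_prefix_subset: "set (hat_prefix P X) \<subseteq> set X"
  by (rule hat_prefix_cases[of P X]) (auto dest: in_set_takeD)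

lemma set_hat_suffix_subset: "set (hat_suffix P X) \<subseteq> set X"
  by (rule hat_suffix_cases[of P X]) (auto dest: in_set_dropD)

text \<open>The interval splits \<open>X\<close> into three consecutive pieces, and the middle one
  contains \<open>P\<close> as a subsequence.\<close>

lemma count_list_minimal_interval:
  assumes "minimal_interval P X b e"
  shows "count_list (take (b - 1) X) y + count_list P y + count_list (drop e X) y \<le> count_list X y"
proof -
  have "X = take (b - 1) (take e X) @ substr X b e @ drop e X"
    by (simp only: substr_def append_take_drop_id append_assoc[symmetric])
  \<comment> \<open>The inner cut is harmless since \<open>b - 1 \<le> e\<close>.\<close>
  moreover have "take (b - 1) (take e X) = take (b - 1) X"
    using assms by (auto simp: minimal_interval_def min_def)
  ultimately have "count_list X y
    = count_list (take (b - 1) X) y + (count_list (substr X b e) y + count_list (drop e X) y)"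
    by (metis count_list_append)
  moreover have "count_list P y \<le> count_list (substr X b e) y"
    using assms by (simp add: minimal_interval_def subseq_imp_count_list_le)
  ultimately show ?thesis by simp
qed

text \<open>If \<open>P\<close> uses up every \<open>y\<close> of \<open>X\<close>, each minimal
  interval contains them all and none is left outside.\<close>

lemma notin_set_hat_prefix:
  assumes "count_list X y = count_list P y"
  shows "y \<notin> set (hat_prefix P X)"
proof (rule hat_prefix_cases[of P X])
  fix b e
  assume "minimal_interval P X b e" "hat_prefix P X = take (b - 1) X"
  then show ?thesis
    using count_list_minimal_interval[of P X b e y] assms by (simp add: count_list_0_iff)
qed simp

lemma notin_set_hat_suffix:
  assumes "count_list X y = count_list P y"
  shows "y \<notin> set (hat_suffix P X)"
proof (rule hat_suffix_cases[of P X])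
  fix b e
  assume "minimal_interval P X b e" "hat_suffix P X = drop e X"
  then show ?thesis
    using count_list_minimal_interval[of P X b e y] assms by (simp add: count_list_0_iff)
qed simp


section \<open>Space\<close>

lemma length_interval_array: "length (interval_array P X) = length X"
  by (simp add: interval_array_def del: upt_Suc)

lemma words_memory_II_le:
  assumes "length A = n" "length B = n"
  shows "words (memory_II A B P) \<le> 4 * n\<^sup>2 + 4 * n"
  using assms card_dom_sparse_table_le[of A B] card_dom_sparse_table_le[of B A]
    card_dom_sparse_table_le[of "rev A" "rev B"] card_dom_sparse_table_le[of "rev B" "rev A"]
  by (simp add: words_def memory_II_def length_interval_array)

lemma words_memory_II_ge: "card (dom (sparse_table A B)) \<le> words (memory_II A B P)"
  by (simp add: words_def memory_II_def)

text \<open>Four tables confined to one row and four arrays, each contributing at most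
  \<open>n\<close> words.\<close>

lemma words_memory_III_le:
  assumes "length A = n" "length B = n"
    and "lcs (hat_prefix P A) (hat_prefix P B) = 0" "lcs (hat_prefix P B) (hat_prefix P A) = 0"
    and "lcs (rev (hat_suffix P A)) (rev (hat_suffix P B)) = 0"
      "lcs (rev (hat_suffix P B)) (rev (hat_suffix P A)) = 0"
  shows "words (memory_III A B P) \<le> 8 * n"
  using assms(1,2) assms(3-6)[THEN card_dom_sparse_table_le_if_lcs_eq_0]
    length_hat_prefix_le[of P A] length_hat_prefix_le[of P B]
    length_hat_suffix_le[of P A] length_hat_suffix_le[of P B]
  by (simp add: words_def memory_III_def Let_def length_interval_array)

lemma words_memory_III_replicate_le:
  assumes "x \<noteq> y" "m + k = n"
  shows "words (memory_III (replicate n y) (replicate m x @ replicate k y) (replicate k y)) \<le> 8 * n"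
    (is "words (memory_III ?A ?B ?P) \<le> _")
proof (rule words_memory_III_le)
  have "count_list ?B y = count_list ?P y"
    using assms by (simp add: count_list_replicate)
  then have "y \<notin> set (hat_prefix ?P ?B)" "y \<notin> set (hat_suffix ?P ?B)"
    by (simp_all only: notin_set_hat_prefix notin_set_hat_suffix not_False_eq_True)
  moreover have "set (hat_prefix ?P ?A) \<subseteq> {y}" "set (hat_suffix ?P ?A) \<subseteq> {y}"
    using set_hat_prefix_subset[of ?P ?A] set_hat_suffix_subset[of ?P ?A] by auto
  ultimately show "lcs (hat_prefix ?P ?A) (hat_prefix ?P ?B) = 0"
    "lcs (hat_prefix ?P ?B) (hat_prefix ?P ?A) = 0"
    "lcs (rev (hat_suffix ?P ?A)) (rev (hat_suffix ?P ?B)) = 0"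
    "lcs (rev (hat_suffix ?P ?B)) (rev (hat_suffix ?P ?A)) = 0"
    by (auto intro!: lcs_disjoint)
qed (use assms in simp_all)

theorem lemma6:
  assumes "\<exists>a b :: 'a. a \<noteq> b"
  shows "\<exists>A B P :: nat \<Rightarrow> 'a list.
    (\<forall>n\<ge>1. length (A n) = n \<and> length (B n) = n \<and> 1 \<le> length (P n) \<and> length (P n) \<le> n) \<and>
    (\<forall>w. linear_workspace w \<longrightarrow>
      (\<lambda>n. real (space (algorithm_III w (A n) (B n) (P n)))) \<in> O(\<lambda>n. real n) \<and>
      (\<lambda>n. real (space (algorithm_II w (A n) (B n) (P n)))) \<in> \<Theta>(\<lambda>n. (real n)\<^sup>2))"
proof -
  obtain x y :: 'a where xy: "x \<noteq> y"
    using assms by blast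
  \<comment> \<open>Rounding up makes the pattern nonempty already for \<open>n = 1\<close> and
    gives \<open>n \<le> 2 * k n\<close>.\<close>
  define k :: "nat \<Rightarrow> nat" where "k n = (n + 1) div 2" for n
  define A where "A n = replicate n y" for n
  define B where "B n = replicate (n div 2) x @ replicate (k n) y" for n
  define P where "P n = replicate (k n) y" for n
  have k: "n div 2 + k n = n" for n
    unfolding k_def by presburger
  have lengths: "length (A n) = n" "length (B n) = n" "length (P n) \<le> n" for n
    using k[of n] by (simp_all add: A_def B_def P_def)
  have length_P: "1 \<le> length (P n)" if "n \<ge> 1" for n
    using that by (simp add: P_def k_def)
  have III: "words (memory_III (A n) (B n) (P n)) \<le> 8 * n" for n
    using words_memory_III_replicate_le[OF xy k] by (simp add: A_def B_def P_def)
  have II: "n\<^sup>2 \<le> 4 * words (memory_II (A n) (B n) (P n))" for n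
  proof -
    \<comment> \<open>Both the length and the number of the full diagonals are at least
      \<open>n / 2\<close>, whence the factor 4.\<close>
    have "n \<le> 2 * k n" "n \<le> 2 * (n - k n + 1)"
      unfolding k_def by presburger+
    then have "n * n \<le> (2 * k n) * (2 * (n - k n + 1))"
      by (rule mult_le_mono)
    also have "\<dots> = 4 * (k n * (n - k n + 1))"
      by simp
    also have "k n * (n - k n + 1) \<le> card (dom (sparse_table (A n) (B n)))"
      unfolding A_def B_def using k[of n] by (intro card_dom_sparse_table_replicate_ge[OF _ xy]) simp
    also have "\<dots> \<le> words (memory_II (A n) (B n) (P n))"
      by (rule words_memory_II_ge)
    finally show ?thesis by (simp add: power2_eq_square)
  qed
  have "(\<lambda>n. real (space (algorithm_III w (A n) (B n) (P n)))) \<in> O(\<lambda>n. real n) \<and>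
      (\<lambda>n. real (space (algorithm_II w (A n) (B n) (P n)))) \<in> \<Theta>(\<lambda>n. (real n)\<^sup>2)"
    if w: "linear_workspace w" for w
  proof -
    obtain c where c: "\<And>n. n \<ge> 1 \<Longrightarrow> w (A n) (B n) (P n) \<le> c * n"
      using w length_P lengths unfolding linear_workspace_def by metis
    have "space (algorithm_III w (A n) (B n) (P n)) \<le> (8 + c) * n" if "n \<ge> 1" for n
      using III[of n] c[OF that] by (simp add: space_def algorithm_III_def Let_def algebra_simps)
    then have "real (space (algorithm_III w (A n) (B n) (P n))) \<le> real (8 + c) * real n"
      if "n \<ge> 1" for n
      using that by (metis of_nat_le_iff of_nat_mult)
    then have O_III: "(\<lambda>n. real (space (algorithm_III w (A n) (B n) (P n)))) \<in> O(\<lambda>n. real n)"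
      by (intro bigoI[where c = "real (8 + c)"] eventually_sequentiallyI[of 1]) simp
    have "space (algorithm_II w (A n) (B n) (P n)) \<le> (8 + c) * n\<^sup>2" if "n \<ge> 1" for n
    proof -
      have "n \<le> n\<^sup>2"
        using that by (simp add: power2_eq_square)
      then have "4 * n\<^sup>2 + 4 * n + c * n \<le> 4 * n\<^sup>2 + 4 * n\<^sup>2 + c * n\<^sup>2"
        by (intro add_mono mult_le_mono2) simp_all
      then show ?thesis
        using words_memory_II_le[OF lengths(1,2), of n "P n"] c[OF that]
        by (simp add: space_def algorithm_II_def Let_def algebra_simps)
    qed
    then have "real (space (algorithm_II w (A n) (B n) (P n))) \<le> real (8 + c) * (real n)\<^sup>2"
      if "n \<ge> 1" for n
      using that by (metis of_nat_le_iff of_nat_mult of_nat_power)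
    then have O_II: "(\<lambda>n. real (space (algorithm_II w (A n) (B n) (P n)))) \<in> O(\<lambda>n. (real n)\<^sup>2)"
      by (intro bigoI[where c = "real (8 + c)"] eventually_sequentiallyI[of 1]) simp
    have "n\<^sup>2 \<le> 4 * space (algorithm_II w (A n) (B n) (P n))" for n
      using II[of n] by (simp add: space_def algorithm_II_def Let_def)
    then have "(real n)\<^sup>2 \<le> 4 * real (space (algorithm_II w (A n) (B n) (P n)))" for n
      by (metis of_nat_le_iff of_nat_mult of_nat_numeral of_nat_power)
    then have "(\<lambda>n. (real n)\<^sup>2) \<in> O(\<lambda>n. real (space (algorithm_II w (A n) (B n) (P n))))"
      by (intro bigoI[where c = 4]) simp
    with O_III O_II show ?thesis
      by (simp add: bigtheta_def bigomega_iff_bigo)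
  qed
  then show ?thesis
    using lengths length_P by blast
qed

end
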